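(* Let $\ell\ge 1$ and let $$A_{\ell,1}(x,t)= \sum_{w \in [\ell]^*} x^{\mathrm{bond}(w)}t^{|w|}.$$ Then $$A_{\ell,1}(x,t)=1+(\underbrace{1,\ldots,1}_{\ell})\,\mathbb{A}_{\ell,1}^{-1}\,(\underbrace{-t,\ldots,-t}_{\ell})^{T},$$ where $\mathbb{A}_{\ell,1}$ is the $\ell\times\ell$ matrix all of whose main-diagonal entries equal $xt-1$, all of whose entries on the first superdiagonal and the first subdiagonal equal $xt$, and all of whose other entries equal $t$.
   Context: $[\ell]=\{1,2,\ldots,\ell\}$, $[\ell]^*$ is the set of all finite words over $[\ell]$ (including the empty word), and $|w|$ is the length of $w$. A bond in a word $w=w_1\cdots w_n$ is a pair of consecutive letters $w_iw_{i+1}$ of the form $s(s+1)$, $(s+1)s$, or $ss$ for some $s$, i.e. with $|w_i-w_{i+1}|\le 1$; $\mathrm{bond}(w)$ is the number of indices $i\in\{1,\dots,n-1\}$ such that $w_iw_{i+1}$ is a bond. The identity is one of formal power series in $t$ with coefficients in $\mathbb{Z}[x]$ (at $t=0$ the matrix equals minus the identity, so it is invertible). *)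

theory Defs
  imports
    "Jordan_Normal_Form.Matrix"
    "HOL-Computational_Algebra.Formal_Power_Series"
    "HOL-Computational_Algebra.Polynomial"
    "HOL-Analysis.Infinite_Sum"
begin

definition bond :: "nat list \<Rightarrow> nat" where
  "bond w = card {i. Suc i < length w \<and> \<bar>int (w ! i) - int (w ! Suc i)\<bar> \<le> 1}"

text \<open>The ring of formal power series in \<open>t\<close> over \<open>\<int>[x]\<close> is \<^typ>\<open>int poly fps\<close>;
  the indeterminate \<open>t\<close> is \<^term>\<open>fps_X :: int poly fps\<close>, and \<open>x\<close> is the following constant series.\<close>

abbreviation (input) var_x :: "int poly fps" where
  "var_x \<equiv> fps_const [:0, 1:]"

abbreviation (input) var_t :: "int poly fps" where
  "var_t \<equiv> fps_X"

text \<open>The infinite sum is taken in the \<open>t\<close>-adic topology (the metric of type \<open>fps\<close>). It really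
  converges, as \<open>word_gf_has_sum\<close> below shows, so the default value of \<^const>\<open>infsum\<close> plays no role.\<close>

definition word_gf :: "nat \<Rightarrow> int poly fps" where
  "word_gf l = (\<Sum>\<^sub>\<infinity>w\<in>lists {1..l}. var_x ^ bond w * var_t ^ length w)"

definition bond_mat :: "nat \<Rightarrow> int poly fps mat" where
  "bond_mat l = mat l l (\<lambda>(i, j).
     if i = j then var_x * var_t - 1
     else if j = Suc i \<or> i = Suc j then var_x * var_t
     else var_t)"

text \<open>Inverse of a matrix over an arbitrary ring, meaningful if \<^prop>\<open>invertible_mat A\<close>.\<close>

definition mat_inv :: "'a :: semiring_1 mat \<Rightarrow> 'a mat" where
  "mat_inv A = (THE B. inverts_mat A B \<and> inverts_mat B A)"

lemma inverts_mat_carrier: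
  assumes "A \<in> carrier_mat n n" "inverts_mat A B" "inverts_mat B A"
  shows "B \<in> carrier_mat n n"
proof -
  have "dim_col B = n"
    using assms(1,2) unfolding inverts_mat_def
    by (metis carrier_matD(1) index_mult_mat(3) index_one_mat(3))
  moreover have "dim_row B = n"
    using assms(1,3) unfolding inverts_mat_def
    by (metis carrier_matD(2) index_mult_mat(3) index_one_mat(3))
  ultimately show ?thesis by auto
qed

lemma mat_inv_eqI:
  assumes "square_mat A" "inverts_mat A B" "inverts_mat B A"
  shows "mat_inv A = B"
  unfolding mat_inv_def
proof (rule the_equality)
  define n where "n = dim_row A"
  have A: "A \<in> carrier_mat n n"
    using assms(1) by (auto simp: n_def)
  have B: "B \<in> carrier_mat n n"
    using inverts_mat_carrier[OF A assms(2,3)] .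
  show "inverts_mat A B \<and> inverts_mat B A" using assms by simp
  fix C assume C: "inverts_mat A C \<and> inverts_mat C A"
  have C': "C \<in> carrier_mat n n"
    using inverts_mat_carrier[OF A] C by blast
  have "C = C * (A * B)"
    using assms(2) A C' by (simp add: inverts_mat_def)
  also have "\<dots> = (C * A) * B"
    using A B C' by simp
  also have "\<dots> = B"
    using C B C' by (simp add: inverts_mat_def)
  finally show "C = B" .
qed

lemma word_gf_has_sum:
  "((\<lambda>w. var_x ^ bond w * var_t ^ length w) has_sum
     Abs_fps (\<lambda>n. \<Sum>w | w \<in> lists {1..l} \<and> length w = n. [:0, 1:] ^ bond w)) (lists {1..l})"
  (is "(?f has_sum ?S) ?L")
  unfolding has_sum_def tendsto_fps_iff
proof
  fix n
  let ?W = "{w \<in> ?L. length w = n}"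
  have fin: "finite ?W"
    using finite_lists_length_eq[of "{1..l}" n] by (simp add: lists_eq_set conj_commute)
  have nth: "fps_nth (?f w) n = (if length w = n then [:0, 1:] ^ bond w else 0)" for w
    by (simp add: fps_const_power fps_X_power_nth)
  have "sum (\<lambda>w. fps_nth (?f w) n) F = fps_nth ?S n"
    if "finite F" "?W \<subseteq> F" "F \<subseteq> ?L" for F
  proof -
    have "sum (\<lambda>w. fps_nth (?f w) n) F = sum (\<lambda>w. fps_nth (?f w) n) ?W"
      using that by (intro sum.mono_neutral_right) (auto simp: nth)
    also have "\<dots> = fps_nth ?S n"
      by (simp add: nth)
    finally show ?thesis .
  qed
  then show "\<forall>\<^sub>F F in finite_subsets_at_top ?L. fps_nth (sum ?f F) n = fps_nth ?S n"
    unfolding eventually_finite_subsets_at_top fps_sum_nth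
    using fin by (intro exI[of _ ?W]) auto
qed

lemma word_gf_nth:
  "fps_nth (word_gf l) n = (\<Sum>w | w \<in> lists {1..l} \<and> length w = n. [:0, 1:] ^ bond w)"
  unfolding word_gf_def infsumI[OF word_gf_has_sum] by (rule fps_nth_Abs_fps)

end

theory Submission
  imports Defs
begin

text \<open>
  Write the matrix as \<open>tW - 1\<close>, where \<open>W\<close> is the transfer matrix over \<open>\<int>[x]\<close> with entry \<open>x\<close> at
  bonds and \<open>1\<close> elsewhere. Its inverse is the negated geometric series \<open>- (\<Sum>n. t\<^sup>n W\<^sup>n)\<close>. The sum of
  the entries of \<open>W\<^sup>n\<close> counts the words of length \<open>n + 1\<close> by bonds, so it is the
  coefficient of \<open>t\<close> to the power \<open>n + 1\<close> on both sides.
\<close>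

definition shifted_mat :: "'a :: comm_ring_1 mat \<Rightarrow> 'a fps mat" where
  "shifted_mat A = mat (dim_row A) (dim_col A)
     (\<lambda>(i, j). fps_X * fps_const (A $$ (i, j)) - (if i = j then 1 else 0))"

text \<open>Each entry is a single power series whose \<open>n\<close>-th coefficient is an entry of
  the \<open>n\<close>-th matrix power, so no convergence of matrix-valued series has to be
  treated.\<close>

definition neumann_mat :: "'a :: comm_ring_1 mat \<Rightarrow> 'a fps mat" where
  "neumann_mat A = mat (dim_row A) (dim_col A)
     (\<lambda>(i, j). - Abs_fps (\<lambda>n. (A ^\<^sub>m n) $$ (i, j)))"

text \<open>\<open>pow_mat\<close> recurses by multiplying on the right. The left form suits the
  product with \<open>shifted_mat A\<close> in front and, later, prepending a letter to a
  word.\<close>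

lemma pow_mat_Suc_left:
  assumes "A \<in> carrier_mat n n"
  shows "A ^\<^sub>m Suc k = A * A ^\<^sub>m k"
proof (induction k)
  case 0
  show ?case using assms by simp
next
  case (Suc k)
  have "A ^\<^sub>m Suc (Suc k) = (A * A ^\<^sub>m k) * A"
    using Suc by simp
  also have "\<dots> = A * (A ^\<^sub>m k * A)"
    using assms by (intro assoc_mult_mat) auto
  finally show ?case by simp
qed

text \<open>The product telescopes: the part coming from \<open>- 1\<close> is the sum of all
  \<open>t^n A^n\<close>, and the part coming from \<open>t A\<close> removes every term except
  \<open>n = 0\<close>.\<close>

lemma shifted_mult_neumann:
  assumes A: "A \<in> carrier_mat n n"
  shows "shifted_mat A * neumann_mat A = 1\<^sub>m n"
proof (rule eq_matI)
  fix i j assume "i < dim_row (1\<^sub>m n :: 'a fps mat)" "j < dim_col (1\<^sub>m n :: 'a fps mat)"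
  then have ij: "i < n" "j < n" by auto
  have "(shifted_mat A * neumann_mat A) $$ (i, j) =
      (\<Sum>k<n. (fps_X * fps_const (A $$ (i, k)) - (if i = k then 1 else 0)) *
        - Abs_fps (\<lambda>m. (A ^\<^sub>m m) $$ (k, j)))"
    using A ij by (simp add: shifted_mat_def neumann_mat_def scalar_prod_def atLeast0LessThan)
  \<comment> \<open>The Kronecker delta leaves only \<open>k = i\<close> in its part of the
    sum.\<close>
  also have "\<dots> = Abs_fps (\<lambda>m. (A ^\<^sub>m m) $$ (i, j)) -
      fps_X * (\<Sum>k<n. fps_const (A $$ (i, k)) * Abs_fps (\<lambda>m. (A ^\<^sub>m m) $$ (k, j)))"
    using ij by (simp add: algebra_simps sum.distrib sum_subtractf sum_distrib_left
        if_distrib[of "\<lambda>c. c * _"] if_distrib[of "\<lambda>c. _ * c"] cong: if_cong)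
  also have "\<dots> = (1\<^sub>m n) $$ (i, j)"
  proof (rule fps_ext)
    fix m
    show "fps_nth (Abs_fps (\<lambda>m. (A ^\<^sub>m m) $$ (i, j)) -
        fps_X * (\<Sum>k<n. fps_const (A $$ (i, k)) * Abs_fps (\<lambda>m. (A ^\<^sub>m m) $$ (k, j)))) m =
      fps_nth ((1\<^sub>m n) $$ (i, j)) m"
    proof (cases m)
      case 0
      then show ?thesis using A ij by simp
    next
      case (Suc k)
      \<comment> \<open>The factor \<open>fps_X\<close> lowers the index to \<open>k\<close>, so the
        two sides of this recursion cancel in the coefficient of index \<open>Suc k\<close>.\<close>
      have "(A ^\<^sub>m Suc k) $$ (i, j) = (\<Sum>q<n. A $$ (i, q) * (A ^\<^sub>m k) $$ (q, j))"
        unfolding pow_mat_Suc_left[OF A] using A ij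
        by (simp add: scalar_prod_def atLeast0LessThan)
      then show ?thesis using Suc ij by (simp add: fps_sum_nth del: pow_mat.simps)
    qed
  qed
  finally show "(shifted_mat A * neumann_mat A) $$ (i, j) = (1\<^sub>m n) $$ (i, j)" .
qed (use A in \<open>auto simp: shifted_mat_def neumann_mat_def\<close>)

text \<open>\<open>mat_inv\<close> is specified by a two-sided inverse. The same telescoping now
  uses the right recursion built into \<open>pow_mat\<close>.\<close>

lemma neumann_mult_shifted:
  assumes A: "A \<in> carrier_mat n n"
  shows "neumann_mat A * shifted_mat A = 1\<^sub>m n"
proof (rule eq_matI)
  fix i j assume "i < dim_row (1\<^sub>m n :: 'a fps mat)" "j < dim_col (1\<^sub>m n :: 'a fps mat)"
  then have ij: "i < n" "j < n" by auto
  have "(neumann_mat A * shifted_mat A) $$ (i, j) =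
      (\<Sum>k<n. - Abs_fps (\<lambda>m. (A ^\<^sub>m m) $$ (i, k)) *
        (fps_X * fps_const (A $$ (k, j)) - (if k = j then 1 else 0)))"
    using A ij by (simp add: shifted_mat_def neumann_mat_def scalar_prod_def atLeast0LessThan)
  also have "\<dots> = Abs_fps (\<lambda>m. (A ^\<^sub>m m) $$ (i, j)) -
      fps_X * (\<Sum>k<n. fps_const (A $$ (k, j)) * Abs_fps (\<lambda>m. (A ^\<^sub>m m) $$ (i, k)))"
    using ij by (simp add: algebra_simps sum.distrib sum_subtractf sum_distrib_left
        if_distrib[of "\<lambda>c. c * _"] if_distrib[of "\<lambda>c. _ * c"] cong: if_cong)
  also have "\<dots> = (1\<^sub>m n) $$ (i, j)"
  proof (rule fps_ext)
    fix m
    show "fps_nth (Abs_fps (\<lambda>m. (A ^\<^sub>m m) $$ (i, j)) -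
        fps_X * (\<Sum>k<n. fps_const (A $$ (k, j)) * Abs_fps (\<lambda>m. (A ^\<^sub>m m) $$ (i, k)))) m =
      fps_nth ((1\<^sub>m n) $$ (i, j)) m"
    proof (cases m)
      case 0
      then show ?thesis using A ij by simp
    next
      case (Suc k)
      have "(A ^\<^sub>m Suc k) $$ (i, j) = (\<Sum>q<n. A $$ (q, j) * (A ^\<^sub>m k) $$ (i, q))"
        using A ij by (simp add: scalar_prod_def atLeast0LessThan mult.commute)
      then show ?thesis using Suc ij by (simp add: fps_sum_nth del: pow_mat.simps)
    qed
  qed
  finally show "(neumann_mat A * shifted_mat A) $$ (i, j) = (1\<^sub>m n) $$ (i, j)" .
qed (use A in \<open>auto simp: shifted_mat_def neumann_mat_def\<close>)

lemma mat_inv_shifted_mat: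
  assumes "A \<in> carrier_mat n n"
  shows "invertible_mat (shifted_mat A)" "mat_inv (shifted_mat A) = neumann_mat A"
proof -
  have sq: "square_mat (shifted_mat A)"
    using assms by (simp add: shifted_mat_def)
  have inv: "inverts_mat (shifted_mat A) (neumann_mat A)"
    "inverts_mat (neumann_mat A) (shifted_mat A)"
    unfolding inverts_mat_def shifted_mult_neumann[OF assms] neumann_mult_shifted[OF assms]
    using assms by (auto simp: shifted_mat_def neumann_mat_def)
  show "invertible_mat (shifted_mat A)"
    unfolding invertible_mat_def using sq inv by blast
  show "mat_inv (shifted_mat A) = neumann_mat A"
    using mat_inv_eqI[OF sq inv] .
qed

definition bond_weight :: "nat \<Rightarrow> nat \<Rightarrow> int poly" where
  "bond_weight a b = (if \<bar>int a - int b\<bar> \<le> 1 then [:0, 1:] else 1)"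

text \<open>Index \<open>i\<close> stands for the letter \<open>Suc i\<close>; the shift preserves
  differences and hence bonds.\<close>

definition transfer_mat :: "nat \<Rightarrow> int poly mat" where
  "transfer_mat l = mat l l (\<lambda>(i, j). bond_weight i j)"

lemma transfer_mat_carrier [simp]: "transfer_mat l \<in> carrier_mat l l"
  by (simp add: transfer_mat_def)

lemma bond_mat_eq_shifted: "bond_mat l = shifted_mat (transfer_mat l)"
  by (rule eq_matI)
    (auto simp: bond_mat_def shifted_mat_def transfer_mat_def bond_weight_def mult.commute
      simp flip: fps_const_1_eq_1)

lemma bond_simps [simp]: "bond [] = 0" "bond [a] = 0"
  by (simp_all add: bond_def)

text \<open>Index 0 tests the new first pair; all other bond positions are those of
  \<open>b # w\<close> moved up by one.\<close>

lemma bond_Cons_Cons: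
  "bond (a # b # w) = (if \<bar>int a - int b\<bar> \<le> 1 then 1 else 0) + bond (b # w)"
proof -
  define P where "P v i \<longleftrightarrow> Suc i < length v \<and> \<bar>int (v ! i) - int (v ! Suc i)\<bar> \<le> 1" for v i
  have bond: "bond v = card {i. P v i}" for v
    by (simp add: bond_def P_def)
  have "{i. P (a # b # w) i} = {i. i = 0 \<and> \<bar>int a - int b\<bar> \<le> 1} \<union> Suc ` {i. P (b # w) i}"
  proof (rule Set.set_eqI)
    fix i
    show "i \<in> {i. P (a # b # w) i} \<longleftrightarrow>
        i \<in> {i. i = 0 \<and> \<bar>int a - int b\<bar> \<le> 1} \<union> Suc ` {i. P (b # w) i}"
      by (cases i) (auto simp: P_def)
  qed
  moreover have "finite {i. P (b # w) i}"
    by (rule finite_subset[of _ "{..<length (b # w)}"]) (auto simp: P_def)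
  ultimately show ?thesis
    unfolding bond by (auto simp: card_image card_Un_disjoint)
qed

definition words :: "nat \<Rightarrow> nat \<Rightarrow> nat list set" where
  "words l n = {w \<in> lists {1..l}. length w = n}"

lemma words_0: "words l 0 = {[]}"
  by (auto simp: words_def)

lemma sum_words_Suc: "(\<Sum>w\<in>words l (Suc n). f w) = (\<Sum>j<l. \<Sum>w\<in>words l n. f (Suc j # w))"
proof -
  have "(\<Sum>j<l. \<Sum>w\<in>words l n. f (Suc j # w)) = (\<Sum>(j, w)\<in>{..<l} \<times> words l n. f (Suc j # w))"
    by (rule sum.cartesian_product)
  also have "\<dots> = (\<Sum>w\<in>words l (Suc n). f w)"
  \<comment> \<open>Letters are at least 1, so the subtraction in \<open>hd w - 1\<close> never
    truncates.\<close>
  proof (rule sum.reindex_bij_witness[of _ "\<lambda>w. (hd w - 1, tl w)" "\<lambda>(j, w). Suc j # w"])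
  qed (auto simp: words_def length_Suc_conv)
  finally show ?thesis ..
qed

text \<open>The row index fixes the first letter, and the \<open>n\<close> matrix factors weigh the
  \<open>n\<close> adjacent pairs of a word of length \<open>n + 1\<close>. The induction prepends a
  letter, so \<open>i\<close> must vary.\<close>

lemma row_sum_transfer_mat_pow:
  assumes "i < l"
  shows "(\<Sum>j<l. (transfer_mat l ^\<^sub>m n) $$ (i, j)) = (\<Sum>w\<in>words l n. [:0, 1:] ^ bond (Suc i # w))"
  using assms
proof (induction n arbitrary: i)
  case 0
  then show ?case by (simp add: words_0 transfer_mat_def)
next
  case (Suc n)
  have "(\<Sum>j<l. (transfer_mat l ^\<^sub>m Suc n) $$ (i, j)) =
      (\<Sum>j<l. \<Sum>k<l. bond_weight i k * (transfer_mat l ^\<^sub>m n) $$ (k, j))"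
    unfolding pow_mat_Suc_left[OF transfer_mat_carrier] using Suc.prems
    by (intro sum.cong refl) (simp add: transfer_mat_def scalar_prod_def atLeast0LessThan)
  \<comment> \<open>Swapping the sums isolates the row sum of row \<open>k\<close>, to which the
    induction hypothesis applies.\<close>
  also have "\<dots> = (\<Sum>k<l. bond_weight i k * (\<Sum>j<l. (transfer_mat l ^\<^sub>m n) $$ (k, j)))"
    by (subst sum.swap) (simp add: sum_distrib_left)
  also have "\<dots> = (\<Sum>k<l. \<Sum>w\<in>words l n. bond_weight i k * [:0, 1:] ^ bond (Suc k # w))"
    using Suc.IH by (simp add: sum_distrib_left)
  also have "\<dots> = (\<Sum>k<l. \<Sum>w\<in>words l n. [:0, 1:] ^ bond (Suc i # Suc k # w))"
    by (intro sum.cong refl) (simp add: bond_Cons_Cons bond_weight_def)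
  finally show ?case by (simp add: sum_words_Suc)
qed

theorem theorem3:
  fixes l :: nat
  assumes "l \<ge> 1"
  shows "invertible_mat (bond_mat l) \<and>
    word_gf l = 1 + scalar_prod (vec l (\<lambda>_. 1)) (mat_inv (bond_mat l) *\<^sub>v vec l (\<lambda>_. - var_t))"
proof
  let ?W = "transfer_mat l"
  show "invertible_mat (bond_mat l)"
    unfolding bond_mat_eq_shifted by (rule mat_inv_shifted_mat(1)[OF transfer_mat_carrier])
  \<comment> \<open>The minus sign of \<open>neumann_mat\<close> cancels that of
    \<open>- var_t\<close>.\<close>
  have "scalar_prod (vec l (\<lambda>_. 1)) (mat_inv (bond_mat l) *\<^sub>v vec l (\<lambda>_. - var_t)) =
      (\<Sum>i<l. \<Sum>j<l. fps_X * Abs_fps (\<lambda>n. (?W ^\<^sub>m n) $$ (i, j)))"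
    unfolding bond_mat_eq_shifted mat_inv_shifted_mat(2)[OF transfer_mat_carrier]
    by (simp add: neumann_mat_def scalar_prod_def atLeast0LessThan transfer_mat_def mult.commute)
  moreover have "word_gf l = 1 + (\<Sum>i<l. \<Sum>j<l. fps_X * Abs_fps (\<lambda>n. (?W ^\<^sub>m n) $$ (i, j)))"
  proof (rule fps_ext)
    fix m
    show "fps_nth (word_gf l) m =
        fps_nth (1 + (\<Sum>i<l. \<Sum>j<l. fps_X * Abs_fps (\<lambda>n. (?W ^\<^sub>m n) $$ (i, j)))) m"
    proof (cases m)
      \<comment> \<open>The empty word gives the summand 1; the factor \<open>fps_X\<close> kills
        the double sum here.\<close>
      case 0
      then show ?thesis
        using words_0[of l] by (simp add: word_gf_nth fps_sum_nth words_def)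
    next
      case (Suc n)
      \<comment> \<open>The factor \<open>fps_X\<close> accounts for the first letter
        \<open>Suc i\<close>, leaving \<open>n\<close> further letters for the \<open>n\<close>-th
        matrix power.\<close>
      have "fps_nth (word_gf l) m = (\<Sum>i<l. \<Sum>w\<in>words l n. [:0, 1:] ^ bond (Suc i # w))"
        unfolding word_gf_nth Suc words_def[symmetric] by (rule sum_words_Suc)
      then show ?thesis
        by (simp add: Suc fps_sum_nth row_sum_transfer_mat_pow)
    qed
  qed
  ultimately show "word_gf l = 1 + scalar_prod (vec l (\<lambda>_. 1))
      (mat_inv (bond_mat l) *\<^sub>v vec l (\<lambda>_. - var_t))"
    by simp
qed

end
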